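(* For an integer $m\ge0$ let $\mathbf{S}_m=\{1,\dots,m\}^2$; say two squares $(i,j),(i',j')$ are on a common diagonal if $i-j=i'-j'$ or $i+j=i'+j'$. Let $R_{\mathbf{W}}(m,k)$ (resp. $R_{\mathbf{K}}(m,k)$) be the number of $k$-element subsets of $\{(i,j)\in\mathbf{S}_m:i+j\text{ even}\}$ (resp. $i+j$ odd) with no two distinct elements on a common diagonal, and let $B_{\mathbf{S}}(m,k)$ be the number of $k$-element subsets of $\mathbf{S}_m$ with no two distinct elements on a common diagonal. Let $\pi(m)=1$ if $m$ is odd and $0$ otherwise. For integers $k\ge0$, $0\le d\le 2k$ and $\varepsilon\in\{0,1\}$ define $$c^{\mathbf{W}}_d(k,\varepsilon)=\sum_{i=d}^{2k}\frac{(-1)^{i-d}}{i!}\left[{i\atop d}\right]\sum_{p=\max(0,i-k)}^{k}\sum_{j=p}^{k}\left\{\!\!\left\{ {p+j \atop p}\right\}\!\!\right\}\beta_i(p+j,k-j,-\varepsilon),$$ $$c^{\mathbf{K}}_d(k,\varepsilon)=\sum_{i=d}^{2k}\frac{(-1)^{i-d}}{i!}\left[{i\atop d}\right]\sum_{p=\max(0,i-k)}^{k}\sum_{j=p}^{k}\left\{\!\!\left\{ {p+j \atop p}\right\}\!\!\right\}\beta_i(p+j,k-j,\varepsilon).$$ Then for all integers $m,k\ge0$, $$R_{\mathbf{W}}(m,k)=\sum_{d=0}^{2k}c^{\mathbf{W}}_d(k,\pi(m))\,m^d,\qquad R_{\mathbf{K}}(m,k)=\sum_{d=0}^{2k}c^{\mathbf{K}}_d(k,\pi(m))\,m^d,$$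 and $$B_{\mathbf{S}}(m,k)=\sum_{d=0}^{2k}\left(\sum_{j=0}^{k}\sum_{i=0}^{d}c^{\mathbf{W}}_i(j,\pi(m))\,c^{\mathbf{K}}_{d-i}(k-j,\pi(m))\right)m^d,$$ where $c^{\mathbf{W}}_i(j,\varepsilon)$ and $c^{\mathbf{K}}_i(j,\varepsilon)$ are taken to be $0$ when $i>2j$.
   Context: $\left[{i\atop d}\right]$ denotes the unsigned Stirling number of the first kind. $\left\{\!\!\left\{ {n \atop r}\right\}\!\!\right\}$ denotes the associated Stirling number of the second kind, defined for integers $n,r\ge0$ by $\left\{\!\!\left\{ {n \atop r}\right\}\!\!\right\}=r\left\{\!\!\left\{ {n-1 \atop r}\right\}\!\!\right\}+(n-1)\left\{\!\!\left\{ {n-2 \atop r-1}\right\}\!\!\right\}$ with $\left\{\!\!\left\{ {0 \atop r}\right\}\!\!\right\}=\delta_{r0}$, $\left\{\!\!\left\{ {1 \atop r}\right\}\!\!\right\}=0$, $\left\{\!\!\left\{ {n \atop 0}\right\}\!\!\right\}=\delta_{n0}$ (the number of partitions of an $n$-set into $r$ blocks each of size at least 2). For nonnegative integers $p,q$, an integer $z$ and $0\le i\le p+q$, $$\beta_i(p,q,z)=\frac{1}{2^{2q}}\sum_{b=\max(0,i-p)}^{q}2^b\binom{2q-b}{q}\sum_{a=0}^{b}\binom{p+b-q-z}{a}\binom{q+z}{b-a}\binom{a-q}{p+b-i},$$ where $\binom{y}{n}=y(y-1)\cdots(y-n+1)/n!$ for integer $n\ge0$ and any $y$. *)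

theory Defs
  imports Complex_Main "HOL-Combinatorics.Stirling"
begin

text \<open>Associated Stirling numbers of the second kind (blocks of size at least 2).\<close>
fun assoc_Stirling :: "nat \<Rightarrow> nat \<Rightarrow> nat" where
  "assoc_Stirling 0 r = (if r = 0 then 1 else 0)"
| "assoc_Stirling (Suc 0) r = 0"
| "assoc_Stirling (Suc (Suc n)) 0 = 0"
| "assoc_Stirling (Suc (Suc n)) (Suc r) =
     Suc r * assoc_Stirling (Suc n) (Suc r) + Suc n * assoc_Stirling n r"

definition beta :: "nat \<Rightarrow> nat \<Rightarrow> nat \<Rightarrow> int \<Rightarrow> real" where
  "beta i p q z = (1 / 2 ^ (2 * q)) *
     (\<Sum>b = i - p..q. 2 ^ b * real ((2 * q - b) choose q) *
        (\<Sum>a = 0..b. (real_of_int (int p + int b - int q - z) gchoose a)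
                    * (real_of_int (int q + z) gchoose (b - a))
                    * (real_of_int (int a - int q) gchoose (p + b - i))))"

definition c_gen :: "int \<Rightarrow> nat \<Rightarrow> nat \<Rightarrow> int \<Rightarrow> real" where
  "c_gen s d k eps = (\<Sum>i = d..2 * k. (-1) ^ (i - d) / fact i * real (stirling i d) *
     (\<Sum>p = i - k..k. \<Sum>j = p..k.
        real (assoc_Stirling (p + j) p) * beta i (p + j) (k - j) (s * eps)))"

definition cW :: "nat \<Rightarrow> nat \<Rightarrow> int \<Rightarrow> real" where
  "cW d k eps = c_gen (-1) d k eps"

definition cK :: "nat \<Rightarrow> nat \<Rightarrow> int \<Rightarrow> real" where
  "cK d k eps = c_gen 1 d k eps"

definition parity_pi :: "nat \<Rightarrow> int" where
  "parity_pi m = (if odd m then 1 else 0)"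

definition board :: "nat \<Rightarrow> (nat \<times> nat) set" where
  "board m = {1..m} \<times> {1..m}"

definition same_diag :: "nat \<times> nat \<Rightarrow> nat \<times> nat \<Rightarrow> bool" where
  "same_diag x y \<longleftrightarrow>
     int (fst x) - int (snd x) = int (fst y) - int (snd y) \<or> fst x + snd x = fst y + snd y"

definition non_attacking :: "(nat \<times> nat) set \<Rightarrow> bool" where
  "non_attacking A \<longleftrightarrow> (\<forall>x\<in>A. \<forall>y\<in>A. x \<noteq> y \<longrightarrow> \<not> same_diag x y)"

definition count_na :: "(nat \<times> nat) set \<Rightarrow> nat \<Rightarrow> nat" where
  "count_na T k = card {A. A \<subseteq> T \<and> card A = k \<and> non_attacking A}"

definition RW :: "nat \<Rightarrow> nat \<Rightarrow> nat" where
  "RW m k = count_na {x \<in> board m. even (fst x + snd x)} k"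

definition RK :: "nat \<Rightarrow> nat \<Rightarrow> nat" where
  "RK m k = count_na {x \<in> board m. odd (fst x + snd x)} k"

definition BS :: "nat \<Rightarrow> nat \<Rightarrow> nat" where
  "BS m k = count_na (board m) k"

end

theory Submission
  imports Defs "HOL-Computational_Algebra.Formal_Power_Series"
begin

text \<open>
  The squares of one colour split into diagonals \<open>i - j = d\<close>. Listed by decreasing \<open>\<bar>d\<bar>\<close>, with
  alternating sign of \<open>d\<close>, the antidiagonals met by one diagonal are also met by the next, so the
  colour class is a Ferrers board; its \<open>n\<close>-th diagonal (counting from 0) has length \<open>n\<close> or \<open>n + 1\<close>, alternately.
  The resulting rook recurrence is solved by
  \<open>\<Sum>l. (v choose l) * S(m - l, m - k)\<close>, where \<open>v\<close> counts the diagonals of length \<open>n + 1\<close> and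
  the Stirling numbers \<open>S(x, x - j)\<close> of the second kind are continued polynomially to
  \<open>\<Sum>p. {{p + j, p}} * (x gchoose (p + j))\<close>.

  On the other side, \<open>\<Sum>d. c\<^sub>d m ^ d\<close> is the expansion of the same polynomial in the basis
  \<open>m gchoose i\<close>: with \<open>m - z = 2 * v\<close>,
  \<open>\<Sum>i. (m gchoose i) * \<beta>\<^sub>i(p, q, z) = (m - q gchoose p) * (v gchoose q)\<close>. Summing over \<open>i\<close> by
  Vandermonde and over \<open>a\<close> by Nanjundiah's identity leaves
  \<open>\<Sum>b. 2 ^ b * (2 * q - b choose q) * (2 * v - 2 * q + b gchoose b) = 4 ^ q * (v gchoose q)\<close>,
  whose left side is the coefficient of \<open>t ^ q\<close> in \<open>(1 - 2 t) ^ (2 q - 2 v - 1) * (1 - t) ^ (- q - 1)\<close>.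
  Since \<open>1 - (1 - 2 t)\<^sup>2 = 4 t (1 - t)\<close>, both sides satisfy the same difference equation in \<open>v\<close>.
\<close>

section \<open>Binomial identities\<close>

text \<open>Expanding the last factor by Vandermonde in the \<open>of_nat k gchoose j\<close> and
  absorbing these by trinomial revision leaves a Vandermonde sum over \<open>k\<close>. The two
  upper parameters add up to \<open>m + n\<close>, so its value has a natural upper index; after a
  second revision the sum over \<open>j\<close> is Vandermonde too.\<close>

lemma gbinomial_Nanjundiah:
  fixes x y :: "'a::field_char_0"
  shows "(\<Sum>k = 0..n. (of_nat m - x + y gchoose k) * (of_nat n + x - y gchoose (n - k))
            * (x + of_nat k gchoose (m + n)))
         = (x gchoose m) * (y gchoose n)"
proof -
  define A where "A = of_nat m - x + y"
  define B where "B = of_nat n + x - y"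
  have AB: "A - of_nat j + B = of_nat (m + n - j)" if "j \<le> n" for j
    using that by (simp add: A_def B_def of_nat_diff)
  have conv: "(\<Sum>k = 0..n. (A gchoose k) * (B gchoose (n - k)) * (of_nat k gchoose j))
      = (A gchoose j) * (of_nat (m + n - j) gchoose (n - j))" if j: "j \<le> n" for j
  proof -
    have "(\<Sum>k = 0..n. (A gchoose k) * (B gchoose (n - k)) * (of_nat k gchoose j))
        = (\<Sum>k = j..n. (A gchoose k) * (B gchoose (n - k)) * (of_nat k gchoose j))"
      by (rule sum.mono_neutral_right) (auto simp flip: binomial_gbinomial)
    also have "\<dots> = (\<Sum>k = 0..n - j. (A gchoose (k + j)) * (B gchoose (n - (k + j)))
        * (of_nat (k + j) gchoose j))"
      using j sum.shift_bounds_cl_nat_ivl[of "\<lambda>k. (A gchoose k) * (B gchoose (n - k))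
        * (of_nat k gchoose j)" 0 j "n - j"] by simp
    also have "\<dots> = (\<Sum>k = 0..n - j. (A gchoose j)
        * ((A - of_nat j gchoose k) * (B gchoose (n - j - k))))"
    proof (rule sum.cong[OF refl])
      fix k
      show "(A gchoose (k + j)) * (B gchoose (n - (k + j))) * (of_nat (k + j) gchoose j)
          = (A gchoose j) * ((A - of_nat j gchoose k) * (B gchoose (n - j - k)))"
        using gbinomial_trinomial_revision[of j "k + j" A]
        by (simp add: mult_ac add.commute)
    qed
    also have "\<dots> = (A gchoose j) * (A - of_nat j + B gchoose (n - j))"
      by (simp only: sum_distrib_left[symmetric] gbinomial_Vandermonde)
    finally show ?thesis by (simp only: AB[OF j])
  qed
  have "(\<Sum>k = 0..n. (A gchoose k) * (B gchoose (n - k)) * (x + of_nat k gchoose (m + n)))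
      = (\<Sum>k = 0..n. \<Sum>j = 0..n. (x gchoose (m + n - j))
          * ((A gchoose k) * (B gchoose (n - k)) * (of_nat k gchoose j)))"
  proof (rule sum.cong[OF refl])
    fix k assume k: "k \<in> {0..n}"
    have "x + of_nat k gchoose (m + n)
        = (\<Sum>j = 0..m + n. (of_nat k gchoose j) * (x gchoose (m + n - j)))"
      by (simp add: gbinomial_Vandermonde add.commute)
    also have "\<dots> = (\<Sum>j = 0..n. (of_nat k gchoose j) * (x gchoose (m + n - j)))"
      using k by (intro sum.mono_neutral_right) (auto simp flip: binomial_gbinomial)
    finally show "(A gchoose k) * (B gchoose (n - k)) * (x + of_nat k gchoose (m + n))
        = (\<Sum>j = 0..n. (x gchoose (m + n - j))
          * ((A gchoose k) * (B gchoose (n - k)) * (of_nat k gchoose j)))"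
      by (simp add: sum_distrib_left mult_ac)
  qed
  also have "\<dots> = (\<Sum>j = 0..n. (x gchoose (m + n - j))
      * ((A gchoose j) * (of_nat (m + n - j) gchoose (n - j))))"
    by (subst sum.swap, rule sum.cong[OF refl])
       (simp only: sum_distrib_left[symmetric], simp add: conv)
  also have "\<dots> = (\<Sum>j = 0..n. (x gchoose m) * ((A gchoose j) * (x - of_nat m gchoose (n - j))))"
  proof (rule sum.cong[OF refl])
    fix j assume "j \<in> {0..n}"
    then have j: "m \<le> m + n - j" "m + n - j - m = n - j" "(m + n - j) - (n - j) = m"
      "n - j \<le> m + n - j"
      by auto
    \<comment> \<open>Symmetry, available because the upper index is natural, gives the lower index
      \<open>m\<close> that the trinomial revision requires.\<close>
    have "(of_nat (m + n - j) gchoose (n - j) :: 'a) = of_nat (m + n - j) gchoose m"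
      using gbinomial_of_nat_symmetric[OF j(4)] j(3) by simp
    then show "(x gchoose (m + n - j)) * ((A gchoose j) * (of_nat (m + n - j) gchoose (n - j)))
        = (x gchoose m) * ((A gchoose j) * (x - of_nat m gchoose (n - j)))"
      using gbinomial_trinomial_revision[OF j(1), of x] j(2) by (simp add: mult_ac)
  qed
  also have "\<dots> = (x gchoose m) * (A + (x - of_nat m) gchoose n)"
    by (simp only: sum_distrib_left[symmetric] gbinomial_Vandermonde)
  also have "A + (x - of_nat m) = y"
    by (simp add: A_def)
  finally show ?thesis by (simp add: A_def B_def)
qed

section \<open>Generating functions of negative binomial type\<close>

unbundle fps_syntax

text \<open>The power series of \<open>(1 - c t) ^ (- a - 1)\<close>.\<close>
definition neg_binomial_fps :: "'a::field_char_0 \<Rightarrow> 'a \<Rightarrow> 'a fps" where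
  "neg_binomial_fps c a = Abs_fps (\<lambda>n. c ^ n * (a + of_nat n gchoose n))"

lemma neg_binomial_fps_nth [simp]:
  "neg_binomial_fps c a $ n = c ^ n * (a + of_nat n gchoose n)"
  by (simp add: neg_binomial_fps_def)

text \<open>Pascal's rule on coefficients; it replaces the law of exponents for powers of
  \<open>1 - c t\<close>.\<close>

lemma neg_binomial_fps_minus_one:
  "neg_binomial_fps c (a - 1) = (1 - fps_const c * fps_X) * neg_binomial_fps c a"
proof (rule fps_ext)
  fix n
  show "neg_binomial_fps c (a - 1) $ n = ((1 - fps_const c * fps_X) * neg_binomial_fps c a) $ n"
  proof (cases n)
    case (Suc l)
    have "a + of_nat (Suc l) gchoose Suc l
        = (a + of_nat l gchoose l) + (a + of_nat l gchoose Suc l)"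
      using gbinomial_Suc_Suc[of "a + of_nat l" l] by (simp add: add_ac)
    then show ?thesis
      by (simp add: Suc left_diff_distrib mult.assoc algebra_simps del: gbinomial_0)
  qed (simp add: left_diff_distrib mult.assoc)
qed

lemma half_gbinomial_expansion:
  fixes v :: int
  shows "(neg_binomial_fps 2 (2 * of_int v - 2 * of_nat q) * neg_binomial_fps 1 (of_nat q)) $ q
         = (4 ^ q * (of_int v gchoose q) :: 'a::field_char_0)"
proof (induction q arbitrary: v)
  case 0
  show ?case by simp
next
  case (Suc q)
  define D :: "int \<Rightarrow> 'a" where
    "D v = (neg_binomial_fps 2 (2 * of_int v - 2 * of_nat (Suc q))
              * neg_binomial_fps 1 (of_nat (Suc q))) $ Suc q" for v
  \<comment> \<open>Passing from \<open>v + 1\<close> to \<open>v\<close> multiplies the first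
    series by \<open>(1 - 2 t)^2\<close>, so the difference carries the factor
    \<open>4 t (1 - t)\<close>. Here \<open>t\<close> lowers the coefficient index and
    \<open>1 - t\<close> lowers the parameter of the second series, which leads to the case
    \<open>q\<close>.\<close>
  have step: "D (v + 1) - D v = 4 ^ Suc q * (of_int v gchoose q)" for v
  proof -
    let ?a = "2 * of_int v - 2 * of_nat q :: 'a"
    let ?U = "neg_binomial_fps 2 ?a" and ?V = "neg_binomial_fps 1 (of_nat (Suc q)) :: 'a fps"
    have "neg_binomial_fps 2 (?a - 1 - 1)
        = (1 - fps_const 2 * fps_X) * ((1 - fps_const 2 * fps_X) * ?U)"
      by (simp only: neg_binomial_fps_minus_one)
    moreover have "neg_binomial_fps 1 (of_nat q) = (1 - fps_const 1 * fps_X) * ?V"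
      using neg_binomial_fps_minus_one[of 1 "of_nat (Suc q) :: 'a"] by simp
    moreover have "u * w - ((1 - c * x) * ((1 - c * x) * u)) * w = x * (c * c * (u * ((1 - x) * w)))"
      if "c + c = c * c" for u w c x :: "'a fps"
      using that by algebra
    moreover have "fps_const (2::'a) + fps_const 2 = fps_const 2 * fps_const 2"
      by simp
    ultimately have "?U * ?V - neg_binomial_fps 2 (?a - 1 - 1) * ?V
        = fps_X * (fps_const 2 * fps_const 2 * (?U * neg_binomial_fps 1 (of_nat q)))"
      by (simp only: fps_const_1_eq_1 mult_1)
    then have "(?U * ?V - neg_binomial_fps 2 (?a - 1 - 1) * ?V) $ Suc q
        = 4 * (?U * neg_binomial_fps 1 (of_nat q)) $ q"
      by simp
    moreover have "2 * of_int (v + 1) - 2 * of_nat (Suc q) = ?a"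
      and "2 * of_int v - 2 * of_nat (Suc q) = ?a - 1 - 1"
      by simp_all
    ultimately show ?thesis
      by (simp only: D_def fps_sub_nth Suc.IH power_Suc mult.assoc)
  qed
  \<comment> \<open>At \<open>v = Suc q\<close> the first parameter is 0, so the first series is
    geometric with ratio 2 and a known sum of binomials over powers of 2 remains.\<close>
  have start: "D (int (Suc q)) = 4 ^ Suc q"
  proof -
    have "D (int (Suc q)) = (\<Sum>b = 0..Suc q. 2 ^ b
        * (of_nat (Suc q) + of_nat (Suc q - b) gchoose (Suc q - b)))"
      by (simp add: D_def fps_mult_nth gbinomial_of_nat_symmetric flip: binomial_gbinomial)
    also have "\<dots> = (\<Sum>l = 0..Suc q. 2 ^ (Suc q - l) * (of_nat (Suc q) + of_nat l gchoose l))"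
      by (subst sum.atLeastAtMost_rev) (auto intro!: sum.cong)
    also have "\<dots> = (\<Sum>l\<le>Suc q. 2 ^ Suc q * ((of_nat (Suc q + l) gchoose l) / 2 ^ l))"
      by (rule sum.cong) (simp_all add: power_diff atMost_atLeast0 add.assoc)
    also have "\<dots> = 2 ^ Suc q * 2 ^ Suc q"
      by (simp only: sum_distrib_left[symmetric] gbinomial_sum_nat_pow2)
    finally show ?thesis by (simp flip: power_mult_distrib)
  qed
  have "D v = 4 ^ Suc q * (of_int v gchoose Suc q)"
  \<comment> \<open>The difference equation is followed in both directions, since \<open>v\<close>
    may lie below \<open>Suc q\<close>.\<close>
  proof (induction v rule: int_induct[of _ "int (Suc q)"])
    case base
    have "(of_int (int (Suc q)) gchoose Suc q :: 'a) = 1"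
      by (simp only: of_int_of_nat_eq binomial_gbinomial[symmetric] binomial_n_n of_nat_1)
    then show ?case by (simp only: start mult_1_right)
  next
    case (step1 i)
    then show ?case
      using step[of i] gbinomial_Suc_Suc[of "of_int i :: 'a" q] by (simp add: algebra_simps)
  next
    case (step2 i)
    then show ?case
      using step[of "i - 1"] gbinomial_Suc_Suc[of "of_int (i - 1) :: 'a" q]
      by (simp add: algebra_simps)
  qed
  then show ?case by (simp only: D_def)
qed

lemma half_gbinomial_sum:
  fixes v :: int
  shows "(\<Sum>b = 0..q. 2 ^ b * of_nat (2 * q - b choose q)
             * (2 * of_int v - 2 * of_nat q + of_nat b gchoose b))
         = (4 ^ q * (of_int v gchoose q) :: 'a::field_char_0)"
proof -
  have "of_nat (2 * q - b choose q) = (of_nat q + of_nat (q - b) gchoose (q - b) :: 'a)"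
    if "b \<le> q" for b
  proof -
    have "2 * q - b = q + (q - b)" using that by simp
    then show ?thesis
      using binomial_symmetric[of q "q + (q - b)"]
      by (simp add: binomial_gbinomial)
  qed
  then have "(\<Sum>b = 0..q. 2 ^ b * of_nat (2 * q - b choose q)
             * (2 * of_int v - 2 * of_nat q + of_nat b gchoose b))
      = (neg_binomial_fps 2 (2 * of_int v - 2 * of_nat q) * neg_binomial_fps 1 (of_nat q :: 'a)) $ q"
    unfolding fps_mult_nth neg_binomial_fps_nth by (intro sum.cong) simp_all
  then show ?thesis by (simp only: half_gbinomial_expansion)
qed

section \<open>Expansions in binomial coefficients and in powers\<close>

lemma sum_gbinomial_beta:
  fixes v :: int
  assumes N: "p + q \<le> N" and v: "int m - z = 2 * v"
  shows "(\<Sum>i = 0..N. (real m gchoose i) * beta i p q z)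
         = (real m - real q gchoose p) * (real_of_int v gchoose q)"
proof -
  define h where "h b a = (real_of_int (int p + int b - int q - z) gchoose a)
      * (real_of_int (int q + z) gchoose (b - a))" for b a
  define w where "w b = (2 ^ b * real ((2 * q - b) choose q) :: real)" for b
  have four: "(2::real) ^ (2 * q) = 4 ^ q" by (simp add: power_mult)
  have "(\<Sum>i = 0..N. (real m gchoose i) * beta i p q z)
      = (\<Sum>i = 0..N. \<Sum>b = i - p..q. (1 / 4 ^ q) * w b
          * ((real m gchoose i) * (\<Sum>a = 0..b. h b a
              * (real_of_int (int a - int q) gchoose (p + b - i)))))"
    unfolding beta_def h_def w_def four by (simp only: sum_distrib_left mult_ac)
  \<comment> \<open>With truncated subtraction, \<open>i - p \<le> b\<close> says exactly
    \<open>i \<le> p + b\<close>; in this form the sums can be swapped.\<close>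
  also have "\<dots> = (\<Sum>i = 0..N. \<Sum>b \<in> {b. b \<in> {0..q} \<and> i \<le> p + b}. (1 / 4 ^ q) * w b
          * ((real m gchoose i) * (\<Sum>a = 0..b. h b a
              * (real_of_int (int a - int q) gchoose (p + b - i)))))"
    by (intro sum.cong refl) auto
  also have "\<dots> = (\<Sum>b = 0..q. \<Sum>i \<in> {i. i \<in> {0..N} \<and> i \<le> p + b}. (1 / 4 ^ q) * w b
          * ((real m gchoose i) * (\<Sum>a = 0..b. h b a
              * (real_of_int (int a - int q) gchoose (p + b - i)))))"
    by (rule sum.swap_restrict) auto
  also have "\<dots> = (\<Sum>b = 0..q. \<Sum>i = 0..p + b. (1 / 4 ^ q) * w b
          * ((real m gchoose i) * (\<Sum>a = 0..b. h b a
              * (real_of_int (int a - int q) gchoose (p + b - i)))))"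
    using N by (intro sum.cong refl) auto
  also have "\<dots> = (\<Sum>b = 0..q. (1 / 4 ^ q) * w b * (\<Sum>a = 0..b. h b a
      * (\<Sum>i = 0..p + b. (real m gchoose i)
          * (real_of_int (int a - int q) gchoose (p + b - i)))))"
    by (rule sum.cong[OF refl], simp only: sum_distrib_left, subst sum.swap)
       (simp only: mult_ac)
  also have "\<dots> = (\<Sum>b = 0..q. (1 / 4 ^ q) * w b * ((real m - real q gchoose p)
      * (2 * of_int v - 2 * of_nat q + of_nat b gchoose b)))"
  proof (rule sum.cong[OF refl])
    fix b
    let ?y = "2 * of_int v - 2 * of_nat q + of_nat b :: real"
    have "real_of_int (int m - z) = real_of_int (2 * v)" by (simp only: v)
    then have z: "real_of_int z = real m - 2 * of_int v" by simp
    \<comment> \<open>Vandermonde over \<open>i\<close> gives the upper index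
      \<open>m - q + a\<close>; eliminating \<open>z\<close> brings \<open>h b a\<close> into the
      shape of Nanjundiah's identity with \<open>x = m - q\<close> and
      \<open>y = ?y\<close>.\<close>
    have "(\<Sum>a = 0..b. h b a * (\<Sum>i = 0..p + b. (real m gchoose i)
            * (real_of_int (int a - int q) gchoose (p + b - i))))
        = (\<Sum>a = 0..b. (real p - (real m - real q) + ?y gchoose a)
            * (real b + (real m - real q) - ?y gchoose (b - a))
            * (real m - real q + real a gchoose (p + b)))"
      by (rule sum.cong[OF refl], subst gbinomial_Vandermonde)
         (simp add: h_def z algebra_simps)
    then show "(1 / 4 ^ q) * w b * (\<Sum>a = 0..b. h b a * (\<Sum>i = 0..p + b. (real m gchoose i)
            * (real_of_int (int a - int q) gchoose (p + b - i))))
        = (1 / 4 ^ q) * w b * ((real m - real q gchoose p) * (?y gchoose b))"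
      by (simp only: gbinomial_Nanjundiah)
  qed
  also have "\<dots> = (1 / 4 ^ q) * (real m - real q gchoose p)
      * (\<Sum>b = 0..q. w b * (2 * of_int v - 2 * of_nat q + of_nat b gchoose b))"
    by (simp add: sum_distrib_left mult_ac)
  finally show ?thesis by (simp add: w_def half_gbinomial_sum)
qed

text \<open>The unsigned Stirling numbers expand the rising factorial of \<open>- x\<close>, which
  is up to sign the falling factorial of \<open>x\<close>.\<close>

lemma sum_signed_stirling_power:
  fixes x :: "'a::field_char_0"
  shows "(\<Sum>d = 0..i. (-1) ^ (i - d) / fact i * of_nat (stirling i d) * x ^ d) = x gchoose i"
proof -
  have "(-1) ^ (i - d) = (-1) ^ i * ((-1) ^ d :: 'a)" if "d \<le> i" for d
    using that by (auto simp: minus_one_power_iff)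
  then have "(\<Sum>d = 0..i. (-1) ^ (i - d) / fact i * of_nat (stirling i d) * x ^ d)
      = (\<Sum>d\<le>i. (-1) ^ i / fact i * (of_nat (stirling i d) * (- x) ^ d))"
    by (intro sum.cong) (auto simp: power_minus[of x])
  then show ?thesis
    by (simp only: sum_distrib_left[symmetric] stirling_pochhammer gbinomial_pochhammer)
       (simp add: field_simps)
qed

section \<open>Counting non-attacking sets\<close>

lemma finite_board [simp]: "finite (board m)"
  by (simp add: board_def)

lemma count_na_0 [simp]: "finite T \<Longrightarrow> count_na T 0 = 1"
proof -
  assume "finite T"
  then have "{A. A \<subseteq> T \<and> card A = 0 \<and> non_attacking A} = {{}}"
    by (auto simp: non_attacking_def dest: finite_subset)
  then show ?thesis by (simp add: count_na_def)
qed

lemma count_na_empty_Suc [simp]: "count_na {} (Suc k) = 0"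
  by (simp add: count_na_def)

lemma non_attacking_subset: "non_attacking A \<Longrightarrow> B \<subseteq> A \<Longrightarrow> non_attacking B"
  unfolding non_attacking_def by blast

lemma same_diag_sym: "same_diag x y \<longleftrightarrow> same_diag y x"
  by (auto simp: same_diag_def)

lemma non_attacking_insert:
  "non_attacking (insert x A) \<longleftrightarrow> non_attacking A \<and> (\<forall>y\<in>A. y \<noteq> x \<longrightarrow> \<not> same_diag x y)"
  using same_diag_sym by (auto simp: non_attacking_def)

text \<open>A non-attacking set contains at most one square of the diagonal \<open>D\<close>. Given
  \<open>k\<close> non-attacking squares of \<open>T\<close>, each blocks exactly one square of
  \<open>D\<close>, the one on its antidiagonal, and these are distinct, so
  \<open>card D - k\<close> choices remain.\<close>

lemma count_na_add_diagonal:
  fixes d :: int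
  assumes fin: "finite T" "finite D"
    and D: "\<And>x. x \<in> D \<Longrightarrow> int (fst x) - int (snd x) = d"
    and T: "\<And>x. x \<in> T \<Longrightarrow> int (fst x) - int (snd x) \<noteq> d"
    and sums: "\<And>x. x \<in> T \<Longrightarrow> \<exists>y\<in>D. fst y + snd y = fst x + snd x"
  shows "real (count_na (T \<union> D) (Suc k))
    = real (count_na T (Suc k)) + (real (card D) - real k) * real (count_na T k)"
proof -
  define sg :: "nat \<times> nat \<Rightarrow> nat" where "sg x = fst x + snd x" for x
  define P where "P S k = {A. A \<subseteq> S \<and> card A = k \<and> non_attacking A}" for S k
  define free where "free A = {x \<in> D. sg x \<notin> sg ` A}" for A
  have count: "count_na S k = card (P S k)" for S k
    by (simp add: count_na_def P_def)
  have finP: "finite (P S k)" if "finite S" for S k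
    using that by (auto simp: P_def intro: finite_subset[of _ "Pow S"])
  have disj: "T \<inter> D = {}" using D T by auto
  have inj_D: "inj_on sg D"
  proof (rule inj_onI)
    fix x y assume "x \<in> D" "y \<in> D" "sg x = sg y"
    then show "x = y" using D[of x] D[of y] by (simp add: sg_def prod_eq_iff)
  qed
  have card_free: "real (card (free A)) = real (card D) - real k" if A: "A \<in> P T k" for A
  proof -
    have "inj_on sg A"
      using A by (auto simp: P_def non_attacking_def same_diag_def sg_def inj_on_def)
    then have card_sums: "card (sg ` A) = k" using A by (simp add: P_def card_image)
    have "sg ` A \<subseteq> sg ` D"
    proof
      fix t assume "t \<in> sg ` A"
      then obtain x where "x \<in> T" "t = sg x" using A by (auto simp: P_def)
      then show "t \<in> sg ` D" using sums[of x] unfolding sg_def image_iff by metis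
    qed
    moreover have "sg ` {x \<in> D. sg x \<in> S} = S \<inter> sg ` D" for S by auto
    ultimately have "sg ` {x \<in> D. sg x \<in> sg ` A} = sg ` A" by (simp only: Int_absorb2)
    then have "card {x \<in> D. sg x \<in> sg ` A} = card (sg ` A)"
      using card_image[OF inj_on_subset[OF inj_D], of "{x \<in> D. sg x \<in> sg ` A}"] by auto
    moreover have "free A = D - {x \<in> D. sg x \<in> sg ` A}" "{x \<in> D. sg x \<in> sg ` A} \<subseteq> D"
      by (auto simp: free_def)
    then have "card (free A) = card D - card {x \<in> D. sg x \<in> sg ` A}"
      "card {x \<in> D. sg x \<in> sg ` A} \<le> card D"
      using fin by (simp_all add: card_Diff_subset card_mono)
    ultimately show ?thesis using card_sums by (simp add: of_nat_diff)
  qed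
  define ext where "ext = (\<lambda>(A, x). insert x A) ` Sigma (P T k) free"
  have inj_ext: "inj_on (\<lambda>(A, x). insert x A) (Sigma (P T k) free)"
  proof (rule inj_onI, clarify)
    fix A x B y
    assume "A \<in> P T k" "x \<in> free A" "B \<in> P T k" "y \<in> free B" and eq: "insert x A = insert y B"
    then have *: "A \<subseteq> T" "B \<subseteq> T" "x \<in> D" "y \<in> D" by (auto simp: P_def free_def)
    \<comment> \<open>Intersecting with \<open>T\<close> and \<open>D\<close> recovers the old set
      and the new square.\<close>
    then have "A = insert x A \<inter> T" "B = insert y B \<inter> T" using disj by auto
    moreover from * have "{x} = insert x A \<inter> D" "{y} = insert y B \<inter> D" using disj by auto
    ultimately show "A = B \<and> x = y" using eq by auto
  qed
  have "P (T \<union> D) (Suc k) = P T (Suc k) \<union> ext"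
  proof (intro equalityI subsetI)
    fix A assume "A \<in> P (T \<union> D) (Suc k)"
    then have A: "A \<subseteq> T \<union> D" "card A = Suc k" "non_attacking A" by (auto simp: P_def)
    show "A \<in> P T (Suc k) \<union> ext"
    proof (cases "A \<subseteq> T")
      case True
      then show ?thesis using A by (simp add: P_def)
    next
      case False
      then obtain x where x: "x \<in> A" "x \<in> D" using A by auto
      have na: "\<not> same_diag x y" if "y \<in> A - {x}" for y
        using A(3) x that by (auto simp: non_attacking_def)
      have "y \<notin> D" if "y \<in> A - {x}" for y
        using na[OF that] D[of y] D[OF x(2)] by (auto simp: same_diag_def)
      then have "A - {x} \<subseteq> T" using A by auto
      moreover have "card (A - {x}) = k" using A x by simp
      moreover have "non_attacking (A - {x})" using A(3) by (rule non_attacking_subset) auto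
      moreover have "sg x \<noteq> sg y" if "y \<in> A - {x}" for y
        using na[OF that] by (simp add: same_diag_def sg_def)
      then have "x \<in> free (A - {x})" using x(2) unfolding free_def by blast
      moreover have "A = insert x (A - {x})" using x by auto
      ultimately show ?thesis unfolding ext_def P_def by blast
    qed
  next
    fix A assume "A \<in> P T (Suc k) \<union> ext"
    then show "A \<in> P (T \<union> D) (Suc k)"
    proof
      assume "A \<in> ext"
      then obtain B x where B: "B \<subseteq> T" "card B = k" "non_attacking B"
        and x: "x \<in> D" "sg x \<notin> sg ` B" and A: "A = insert x B"
        by (auto simp: ext_def P_def free_def)
      have "\<not> same_diag x y" if "y \<in> B" for y
        using T[of y] B(1) that D[OF x(1)] x(2) by (auto simp: same_diag_def sg_def)
      moreover have "x \<notin> B" "finite B" using x B disj fin finite_subset by auto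
      ultimately show ?thesis
        using B x by (auto simp: P_def A non_attacking_insert)
    qed (auto simp: P_def)
  qed
  moreover have "P T (Suc k) \<inter> ext = {}"
    using disj by (auto simp: P_def ext_def free_def)
  moreover have "finite ext"
    using fin finP by (auto simp: ext_def free_def)
  ultimately have "card (P (T \<union> D) (Suc k)) = card (P T (Suc k)) + card ext"
    using fin finP by (simp add: card_Un_disjoint)
  moreover have "card ext = (\<Sum>A\<in>P T k. card (free A))"
    unfolding ext_def using fin finP
    by (subst card_image[OF inj_ext], subst card_SigmaI) (auto simp: free_def)
  ultimately show ?thesis
    by (simp add: count card_free mult.commute)
qed

lemma count_na_union_independent:
  assumes fin: "finite S" "finite T" and disj: "S \<inter> T = {}"
    and indep: "\<And>x y. x \<in> S \<Longrightarrow> y \<in> T \<Longrightarrow> \<not> same_diag x y"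
  shows "count_na (S \<union> T) k = (\<Sum>j = 0..k. count_na S j * count_na T (k - j))"
proof -
  define P where "P U k = {A. A \<subseteq> U \<and> card A = k \<and> non_attacking A}" for U k
  have count: "count_na U k = card (P U k)" for U k
    by (simp add: count_na_def P_def)
  have finP: "finite (P U k)" if "finite U" for U k
    using that by (auto simp: P_def intro: finite_subset[of _ "Pow U"])
  \<comment> \<open>The inverse cuts a set along \<open>S\<close> and \<open>T\<close>; the tag
    \<open>j\<close> makes the domain a disjoint union, so its size is the convolution.\<close>
  have "bij_betw (\<lambda>(j, A, B). A \<union> B) (SIGMA j:{0..k}. P S j \<times> P T (k - j)) (P (S \<union> T) k)"
  proof (rule bij_betw_byWitness[where f' = "\<lambda>A. (card (A \<inter> S), A \<inter> S, A \<inter> T)"])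
    show "\<forall>a\<in>SIGMA j:{0..k}. P S j \<times> P T (k - j).
        (\<lambda>A. (card (A \<inter> S), A \<inter> S, A \<inter> T)) ((\<lambda>(j, A, B). A \<union> B) a) = a"
    proof
      fix a assume "a \<in> (SIGMA j:{0..k}. P S j \<times> P T (k - j))"
      then obtain j A B where a: "a = (j, A, B)" and "A \<subseteq> S" "B \<subseteq> T" "card A = j"
        by (auto simp: P_def)
      then have "(A \<union> B) \<inter> S = A" "(A \<union> B) \<inter> T = B" using disj by auto
      then show "(\<lambda>A. (card (A \<inter> S), A \<inter> S, A \<inter> T)) ((\<lambda>(j, A, B). A \<union> B) a) = a"
        unfolding a prod.case using \<open>card A = j\<close> by simp
    qed
    show "\<forall>A\<in>P (S \<union> T) k. (\<lambda>(j, A, B). A \<union> B) (card (A \<inter> S), A \<inter> S, A \<inter> T) = A"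
      by (auto simp: P_def)
    show "(\<lambda>(j, A, B). A \<union> B) ` (SIGMA j:{0..k}. P S j \<times> P T (k - j)) \<subseteq> P (S \<union> T) k"
    proof (rule image_subsetI)
      fix a assume "a \<in> (SIGMA j:{0..k}. P S j \<times> P T (k - j))"
      then obtain j A B where a: "a = (j, A, B)" and j: "j \<le> k"
        and *: "A \<subseteq> S" "B \<subseteq> T" "card A = j" "card B = k - j" "non_attacking A" "non_attacking B"
        by (auto simp: P_def)
      then have "card (A \<union> B) = k"
        using j fin disj by (subst card_Un_disjoint) (auto dest: finite_subset)
      moreover have "non_attacking (A \<union> B)"
        unfolding non_attacking_def
      proof (intro ballI impI)
        fix x y assume xy: "x \<in> A \<union> B" "y \<in> A \<union> B" "x \<noteq> y"
        have "\<not> same_diag u w" if "u \<in> A" "w \<in> B" for u w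
          using that indep * by blast
        then show "\<not> same_diag x y"
          using xy *(5,6) same_diag_sym unfolding non_attacking_def by blast
      qed
      ultimately show "(\<lambda>(j, A, B). A \<union> B) a \<in> P (S \<union> T) k"
        using * by (auto simp: P_def a)
    qed
    show "(\<lambda>A. (card (A \<inter> S), A \<inter> S, A \<inter> T)) ` P (S \<union> T) k
        \<subseteq> (SIGMA j:{0..k}. P S j \<times> P T (k - j))"
    proof (rule image_subsetI)
      fix A assume "A \<in> P (S \<union> T) k"
      then have A: "A \<subseteq> S \<union> T" "card A = k" "non_attacking A" by (auto simp: P_def)
      then have "finite A" using fin finite_subset by blast
      moreover have "(A \<inter> S) \<union> (A \<inter> T) = A" using A by auto
      moreover have "(A \<inter> S) \<inter> (A \<inter> T) = {}" using disj by auto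
      ultimately have "card (A \<inter> S) + card (A \<inter> T) = k"
        using card_Un_disjoint[of "A \<inter> S" "A \<inter> T"] A(2) by simp
      then show "(card (A \<inter> S), A \<inter> S, A \<inter> T) \<in> (SIGMA j:{0..k}. P S j \<times> P T (k - j))"
        using non_attacking_subset[OF A(3)] by (auto simp: P_def)
    qed
  qed
  from bij_betw_same_card[OF this] show ?thesis
    using fin finP by (simp add: count card_cartesian_product)
qed

section \<open>The Ferrers board recurrence\<close>

text \<open>The polynomial in \<open>n\<close> that equals the Stirling number of the second kind \<open>S(n, n - j)\<close>.\<close>
definition Stirling_poly :: "nat \<Rightarrow> real \<Rightarrow> real" where
  "Stirling_poly j x = (\<Sum>p = 0..j. real (assoc_Stirling (p + j) p) * (x gchoose (p + j)))"

text \<open>Blocks of size at least 2 need at least \<open>2 * r\<close> elements.\<close>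

lemma assoc_Stirling_eq_0: "n < 2 * r \<Longrightarrow> assoc_Stirling n r = 0"
  by (induction n r rule: assoc_Stirling.induct) auto

lemma assoc_Stirling_Suc_0 [simp]: "assoc_Stirling (Suc n) 0 = 0"
  by (cases n) auto

lemma Stirling_poly_0 [simp]: "Stirling_poly 0 x = 1"
  by (simp add: Stirling_poly_def)

lemma Stirling_poly_at_0: "Stirling_poly (Suc j) 0 = 0"
  by (simp add: Stirling_poly_def)

text \<open>Polynomial form of
  \<open>S(n + 1, n - j) = S(n, n - j - 1) + (n - j) * S(n, n - j)\<close>. Pascal's rule computes
  the difference in \<open>x\<close>, and the recursion of \<open>assoc_Stirling\<close> splits
  it.\<close>

lemma Stirling_poly_step: "Stirling_poly (Suc j) (x + 1) = Stirling_poly (Suc j) x + (x - real j) * Stirling_poly j x"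
proof -
  let ?s = "\<lambda>n r. real (assoc_Stirling n r)"
  have "Stirling_poly (Suc j) (x + 1) - Stirling_poly (Suc j) x
      = (\<Sum>p = 0..Suc j. ?s (p + Suc j) p * (x gchoose (p + j)))"
    unfolding Stirling_poly_def sum_subtractf[symmetric]
    by (rule sum.cong) (simp_all only: add_Suc_right gbinomial_Suc_Suc, simp add: algebra_simps)
  also have "\<dots> = (\<Sum>p = 0..j. ?s (Suc p + Suc j) (Suc p) * (x gchoose (Suc p + j)))"
    by (subst sum.atLeast0_atMost_Suc_shift) simp
  also have "\<dots> = (\<Sum>p = 0..j. real (Suc p) * ?s (Suc p + j) (Suc p) * (x gchoose (Suc p + j)))
      + (\<Sum>p = 0..j. real (Suc (p + j)) * ?s (p + j) p * (x gchoose (Suc (p + j))))"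
    by (simp add: algebra_simps flip: sum.distrib)
  also have "(\<Sum>p = 0..j. real (Suc p) * ?s (Suc p + j) (Suc p) * (x gchoose (Suc p + j)))
      = (\<Sum>p = 0..Suc j. real p * ?s (p + j) p * (x gchoose (p + j)))"
    by (subst sum.atLeast0_atMost_Suc_shift) simp
  \<comment> \<open>The top term \<open>p = Suc j\<close> would need \<open>Suc j\<close> blocks of
    size at least 2 in a set of \<open>2 * j + 1\<close> elements.\<close>
  also have "\<dots> = (\<Sum>p = 0..j. real p * ?s (p + j) p * (x gchoose (p + j)))"
    by (simp add: assoc_Stirling_eq_0)
  also have "\<dots> + (\<Sum>p = 0..j. real (Suc (p + j)) * ?s (p + j) p * (x gchoose (Suc (p + j))))
      = (\<Sum>p = 0..j. (x - real j) * (?s (p + j) p * (x gchoose (p + j))))"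
    unfolding sum.distrib[symmetric]
  proof (rule sum.cong[OF refl])
    fix p
    have "(x - real j) * (x gchoose (p + j))
        = real p * (x gchoose (p + j)) + real (Suc (p + j)) * (x gchoose (Suc (p + j)))"
      using gbinomial_mult_1[of x "p + j"] by (simp add: algebra_simps)
    from arg_cong[OF this, of "\<lambda>t. ?s (p + j) p * t"]
    show "real p * ?s (p + j) p * (x gchoose (p + j))
        + real (Suc (p + j)) * ?s (p + j) p * (x gchoose (Suc (p + j)))
        = (x - real j) * (?s (p + j) p * (x gchoose (p + j)))"
      by (simp only: distrib_left mult_ac)
  qed
  finally show ?thesis by (simp add: Stirling_poly_def sum_distrib_left)
qed

section \<open>The solution of the rook recurrence\<close>

definition rook_sum :: "nat \<Rightarrow> nat \<Rightarrow> nat \<Rightarrow> real" where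
  "rook_sum v n k = (\<Sum>l = 0..k. real (v choose l) * Stirling_poly (k - l) (real n - real l))"

lemma rook_sum_0 [simp]: "rook_sum v n 0 = 1"
  by (simp add: rook_sum_def)

lemma rook_sum_0_0_Suc [simp]: "rook_sum 0 0 (Suc k) = 0"
  by (simp add: rook_sum_def sum.atLeast0_atMost_Suc_shift Stirling_poly_at_0 del: sum.cl_ivl_Suc)

text \<open>\<open>Stirling_poly_step\<close> applies to each term, and its factor
  \<open>(n - l) - (k - l)\<close> does not depend on \<open>l\<close>. This is the effect of adding
  a diagonal of length \<open>n\<close>.\<close>

lemma rook_sum_Suc_n:
  "rook_sum v (Suc n) (Suc k) = rook_sum v n (Suc k) + (real n - real k) * rook_sum v n k"
proof -
  have "real (v choose l) * Stirling_poly (Suc k - l) (real (Suc n) - real l)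
      = real (v choose l) * Stirling_poly (Suc k - l) (real n - real l)
        + (real n - real k) * (real (v choose l) * Stirling_poly (k - l) (real n - real l))"
    if "l \<le> k" for l
  proof -
    have "Stirling_poly (Suc k - l) (real (Suc n) - real l)
        = Stirling_poly (Suc k - l) (real n - real l) + (real n - real k) * Stirling_poly (k - l) (real n - real l)"
    proof -
      have "real (Suc n) - real l = real n - real l + 1"
        "real n - real l - real (k - l) = real n - real k"
        using that by (simp_all add: of_nat_diff)
      then show ?thesis
        using Stirling_poly_step[of "k - l" "real n - real l"] that by (simp only: Suc_diff_le)
    qed
    then show ?thesis by (simp only: distrib_left mult.left_commute)
  qed
  then show ?thesis
    by (simp add: rook_sum_def sum.distrib sum_distrib_left)
qed

text \<open>Pascal's rule in \<open>v\<close>, with \<open>l\<close> shifted by one, contributes one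
  more \<open>rook_sum v n k\<close>, which raises the factor to that of a diagonal of length
  \<open>n + 1\<close>.\<close>

lemma rook_sum_Suc_Suc:
  "rook_sum (Suc v) (Suc n) (Suc k) = rook_sum v n (Suc k) + (real (Suc n) - real k) * rook_sum v n k"
proof -
  have "rook_sum (Suc v) (Suc n) (Suc k) = rook_sum v (Suc n) (Suc k) + rook_sum v n k"
    by (simp add: rook_sum_def sum.atLeast0_atMost_Suc_shift sum.distrib algebra_simps
        del: sum.cl_ivl_Suc)
  then show ?thesis by (simp add: rook_sum_Suc_n algebra_simps)
qed

section \<open>Diagonals of the square board\<close>

definition diag :: "nat \<Rightarrow> int \<Rightarrow> (nat \<times> nat) set" where
  "diag m d = {x \<in> board m. int (fst x) - int (snd x) = d}"

lemma finite_diag [simp]: "finite (diag m d)"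
  by (simp add: diag_def)

lemma card_diag:
  assumes "\<bar>d\<bar> \<le> int m"
  shows "int (card (diag m d)) = int m - \<bar>d\<bar>"
proof -
  \<comment> \<open>The bounds express that both \<open>i\<close> and \<open>i - d\<close> lie
    between 1 and \<open>m\<close>.\<close>
  have "bij_betw fst (diag m d) {nat (max 1 (1 + d))..nat (min (int m) (int m + d))}"
  proof (rule bij_betw_byWitness[where f' = "\<lambda>i. (i, nat (int i - d))"])
    show "(\<lambda>i. (i, nat (int i - d))) ` {nat (max 1 (1 + d))..nat (min (int m) (int m + d))}
        \<subseteq> diag m d"
      by (rule image_subsetI) (auto simp: diag_def board_def)
  qed (auto simp: diag_def board_def)
  from bij_betw_same_card[OF this] show ?thesis
    using assms by (cases "0 \<le> d") (auto simp: min_def max_def of_nat_diff)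
qed

text \<open>Length and index \<open>i - j\<close> of the \<open>n\<close>-th shortest diagonal among those with \<open>i - j \<equiv> m - e\<close> modulo 2,
  where \<open>e \<le> 1\<close>. For \<open>e = 0\<close> the list starts with the empty diagonal \<open>i - j = m\<close>.\<close>
definition diag_len :: "nat \<Rightarrow> nat \<Rightarrow> nat" where
  "diag_len e n = (if even (n + e) then n else Suc n)"

definition diag_diff :: "nat \<Rightarrow> nat \<Rightarrow> nat \<Rightarrow> int" where
  "diag_diff m e n = (if even n then int m - int (diag_len e n) else int (diag_len e n) - int m)"

lemma abs_diag_diff: "n < m \<Longrightarrow> \<bar>diag_diff m e n\<bar> = int m - int (diag_len e n)"
  by (auto simp: diag_diff_def diag_len_def)

lemma even_diag_diff: "even (diag_diff m e n + int m + int e)"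
  by (auto simp: diag_diff_def diag_len_def)

lemma diag_len_mono: "l \<le> n \<Longrightarrow> diag_len e l \<le> diag_len e n"
  by (cases "l = n") (auto simp: diag_len_def)

text \<open>Equal lengths occur only at consecutive indices, where the signs are opposite; the
  common length \<open>n\<close> is below \<open>m\<close>, so the value is not 0.\<close>

lemma diag_diff_inj:
  assumes "l < n" "n < m"
  shows "diag_diff m e l \<noteq> diag_diff m e n"
proof
  assume eq: "diag_diff m e l = diag_diff m e n"
  then have "diag_len e l = diag_len e n"
    using abs_diag_diff[of l m e] abs_diag_diff[of n m e] assms by simp
  then have "n = Suc l" "diag_len e n = n"
    using assms by (auto simp: diag_len_def split: if_splits)
  then show False
    using eq assms by (auto simp: diag_diff_def diag_len_def split: if_splits)
qed

definition first_diags :: "nat \<Rightarrow> nat \<Rightarrow> nat \<Rightarrow> (nat \<times> nat) set" where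
  "first_diags m e n = (\<Union>l<n. diag m (diag_diff m e l))"

lemma count_na_first_diags:
  assumes "e \<le> 1" "n \<le> m"
  shows "real (count_na (first_diags m e n) k) = rook_sum ((n + e) div 2) n k"
  using assms(2)
proof (induction n arbitrary: k)
  case 0
  then show ?case using \<open>e \<le> 1\<close> by (cases k) (auto simp: first_diags_def)
next
  case (Suc n)
  show ?case
  proof (cases k)
    case 0
    then show ?thesis by (simp add: first_diags_def)
  next
    case (Suc j)
    let ?T = "first_diags m e n" and ?d = "diag_diff m e n"
    have n: "n < m" using Suc.prems by simp
    have b: "diag_len e n \<le> m" using n by (auto simp: diag_len_def)
    have union: "first_diags m e (Suc n) = ?T \<union> diag m ?d"
      by (auto simp: first_diags_def less_Suc_eq)
    have "real (count_na (?T \<union> diag m ?d) (Suc j))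
        = real (count_na ?T (Suc j)) + (real (card (diag m ?d)) - real j) * real (count_na ?T j)"
    proof (rule count_na_add_diagonal)
      fix x assume "x \<in> ?T"
      then obtain l where l: "l < n" and x: "x \<in> diag m (diag_diff m e l)"
        by (auto simp: first_diags_def)
      show "int (fst x) - int (snd x) \<noteq> ?d"
        using x diag_diff_inj[OF l n] by (simp add: diag_def)
      have xd: "int (fst x) - int (snd x) = diag_diff m e l"
        and xb: "fst x \<in> {1..m}" "snd x \<in> {1..m}"
        using x by (auto simp: diag_def board_def)
      have le: "\<bar>?d\<bar> \<le> \<bar>int (fst x) - int (snd x)\<bar>"
        using abs_diag_diff[of l m e] abs_diag_diff[of n m e] n l diag_len_mono[of l n e]
        by (simp add: xd)
      have "even (diag_diff m e l + ?d)"
        using even_diag_diff[of m e l] even_diag_diff[of m e n] by presburger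
      then have "even (int (fst x) + int (snd x) + ?d)"
        unfolding xd[symmetric] by presburger
      \<comment> \<open>The square of the new diagonal with the same sum has coordinates
        \<open>i\<close> and \<open>i - ?d\<close>. Parity makes them integers, and
        \<open>le\<close> places them between the coordinates of \<open>x\<close>, hence on the
        board.\<close>
      then obtain i where i: "int (fst x) + int (snd x) + ?d = 2 * i" by (elim evenE)
      have "(nat i, nat (i - ?d)) \<in> diag m ?d \<and> nat i + nat (i - ?d) = fst x + snd x"
        using i le xb by (auto simp: diag_def board_def)
      then show "\<exists>y\<in>diag m ?d. fst y + snd y = fst x + snd x"
        by (metis fst_conv snd_conv)
    qed (auto simp: first_diags_def diag_def)
    moreover have "card (diag m ?d) = diag_len e n"
      using card_diag[of ?d m] abs_diag_diff[OF n, of e] b by simp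
    ultimately have "real (count_na (first_diags m e (Suc n)) k)
        = rook_sum ((n + e) div 2) n (Suc j)
          + (real (diag_len e n) - real j) * rook_sum ((n + e) div 2) n j"
      using Suc.IH n by (simp add: union Suc)
    \<comment> \<open>The new diagonal has length \<open>Suc n\<close> exactly when
      \<open>n + e\<close> is odd, which is when \<open>(n + e) div 2\<close> grows.\<close>
    also have "\<dots> = rook_sum ((Suc n + e) div 2) (Suc n) (Suc j)"
    proof (cases "even (n + e)")
      case True
      then have "(Suc n + e) div 2 = (n + e) div 2" by simp
      then show ?thesis using True by (simp only: diag_len_def rook_sum_Suc_n if_True)
    next
      case False
      then have "(Suc n + e) div 2 = Suc ((n + e) div 2)" by simp
      then show ?thesis using False by (simp only: diag_len_def rook_sum_Suc_Suc if_False)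
    qed
    finally show ?thesis by (simp add: Suc)
  qed
qed

lemma first_diags_all:
  assumes "e \<le> 1"
  shows "first_diags m e m = {x \<in> board m. even (fst x + snd x + m + e)}"
proof (intro equalityI subsetI)
  fix x assume "x \<in> first_diags m e m"
  then obtain l where "x \<in> board m" "int (fst x) - int (snd x) = diag_diff m e l"
    by (auto simp: first_diags_def diag_def)
  then show "x \<in> {x \<in> board m. even (fst x + snd x + m + e)}"
    using even_diag_diff[of m e l] by simp presburger
next
  fix x assume "x \<in> {x \<in> board m. even (fst x + snd x + m + e)}"
  then have x: "x \<in> board m" and ev: "even (fst x + snd x + m + e)" by auto
  define d where "d = int (fst x) - int (snd x)"
  define b where "b = nat (int m - \<bar>d\<bar>)"
  \<comment> \<open>Length \<open>b\<close> occurs at the indices \<open>b - 1\<close> and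
    \<open>b\<close>; the parity of the index must match the sign of \<open>d\<close>. For
    \<open>d = 0\<close> index \<open>b = m\<close> is out of range and the sign is
    irrelevant.\<close>
  define n where "n = (if even b = (d \<ge> 0) \<and> b < m then b else b - 1)"
  have b: "int b = int m - \<bar>d\<bar>" "1 \<le> b" "b \<le> m"
    using x by (auto simp: b_def d_def board_def)
  have eb: "even (b + e)"
  proof -
    have "even (int (fst x) + int (snd x) + int m + int e)"
      using ev by (metis even_of_nat of_nat_add)
    then have "even (int b + int e)" unfolding b(1) d_def by presburger
    then show ?thesis by (metis even_of_nat of_nat_add)
  qed
  have n: "n \<in> {..<m}" using b by (auto simp: n_def)
  have "diag_len e n = b"
    using eb b by (auto simp: n_def diag_len_def)
  then have "diag_diff m e n = d"
    using b by (auto simp: diag_diff_def n_def split: if_splits)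
  then have "x \<in> diag m (diag_diff m e n)" using x by (simp add: diag_def d_def)
  with n show "x \<in> first_diags m e m" unfolding first_diags_def by (rule UN_I)
qed

lemma count_na_parity_class:
  assumes "e \<le> 1"
  shows "real (count_na {x \<in> board m. even (fst x + snd x + m + e)} k)
    = rook_sum ((m + e) div 2) m k"
  using count_na_first_diags[OF assms, of m m k] first_diags_all[OF assms, of m] by simp

section \<open>The polynomial formulas\<close>

lemma beta_eq_0: "p + q < i \<Longrightarrow> beta i p q z = 0"
  by (simp add: beta_def)

lemma sum_c_gen:
  assumes v: "int m - s * eps = 2 * int v"
  shows "(\<Sum>d = 0..2 * k. c_gen s d k eps * real m ^ d) = rook_sum v m k"
proof -
  let ?s = "\<lambda>p j. real (assoc_Stirling (p + j) p)"
  let ?X = "\<lambda>i. \<Sum>p = 0..k. \<Sum>j = p..k. ?s p j * beta i (p + j) (k - j) (s * eps)"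
  \<comment> \<open>The added terms have \<open>(p + j) + (k - j) = p + k < i\<close>, where
    \<open>beta\<close> vanishes; the range of \<open>p\<close> is now independent of
    \<open>i\<close>.\<close>
  have X: "(\<Sum>p = i - k..k. \<Sum>j = p..k. ?s p j * beta i (p + j) (k - j) (s * eps)) = ?X i" for i
  proof (rule sum.mono_neutral_left)
    show "\<forall>p\<in>{0..k} - {i - k..k}. (\<Sum>j = p..k. ?s p j * beta i (p + j) (k - j) (s * eps)) = 0"
      by (intro ballI sum.neutral) (auto intro!: beta_eq_0)
  qed auto
  have "(\<Sum>d = 0..2 * k. c_gen s d k eps * real m ^ d)
      = (\<Sum>d = 0..2 * k. \<Sum>i = d..2 * k.
          ((-1) ^ (i - d) / fact i * real (stirling i d) * real m ^ d) * ?X i)"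
    unfolding c_gen_def X sum_distrib_right[of _ _ "_ ^ _"] by (simp only: mult_ac)
  also have "\<dots> = (\<Sum>d = 0..2 * k. \<Sum>i \<in> {i. i \<in> {0..2 * k} \<and> d \<le> i}.
          ((-1) ^ (i - d) / fact i * real (stirling i d) * real m ^ d) * ?X i)"
    by (intro sum.cong refl) auto
  also have "\<dots> = (\<Sum>i = 0..2 * k. \<Sum>d \<in> {d. d \<in> {0..2 * k} \<and> d \<le> i}.
          ((-1) ^ (i - d) / fact i * real (stirling i d) * real m ^ d) * ?X i)"
    by (rule sum.swap_restrict) auto
  also have "\<dots> = (\<Sum>i = 0..2 * k. \<Sum>d = 0..i.
          ((-1) ^ (i - d) / fact i * real (stirling i d) * real m ^ d) * ?X i)"
    by (intro sum.cong refl) auto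
  also have "\<dots> = (\<Sum>i = 0..2 * k. (real m gchoose i) * ?X i)"
    unfolding sum_distrib_right[symmetric] sum_signed_stirling_power ..
  also have "\<dots> = (\<Sum>i = 0..2 * k. \<Sum>p = 0..k. \<Sum>j = p..k.
      ?s p j * ((real m gchoose i) * beta i (p + j) (k - j) (s * eps)))"
    by (simp only: sum_distrib_left mult_ac)
  also have "\<dots> = (\<Sum>p = 0..k. \<Sum>j = p..k. \<Sum>i = 0..2 * k.
      ?s p j * ((real m gchoose i) * beta i (p + j) (k - j) (s * eps)))"
    by (subst sum.swap, rule sum.cong[OF refl], rule sum.swap)
  also have "\<dots> = (\<Sum>p = 0..k. \<Sum>j = p..k.
      ?s p j * ((real m - real (k - j) gchoose (p + j)) * real (v choose (k - j))))"
  proof (intro sum.cong refl)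
    fix p j assume "p \<in> {0..k}" "j \<in> {p..k}"
    then have "p + j + (k - j) \<le> 2 * k" by auto
    from sum_gbinomial_beta[OF this v]
    show "(\<Sum>i = 0..2 * k. ?s p j * ((real m gchoose i) * beta i (p + j) (k - j) (s * eps)))
        = ?s p j * ((real m - real (k - j) gchoose (p + j)) * real (v choose (k - j)))"
      by (simp add: binomial_gbinomial flip: sum_distrib_left)
  qed
  also have "\<dots> = (\<Sum>p = 0..k. \<Sum>j \<in> {j. j \<in> {0..k} \<and> p \<le> j}.
      ?s p j * ((real m - real (k - j) gchoose (p + j)) * real (v choose (k - j))))"
    by (intro sum.cong refl) auto
  also have "\<dots> = (\<Sum>j = 0..k. \<Sum>p \<in> {p. p \<in> {0..k} \<and> p \<le> j}.
      ?s p j * ((real m - real (k - j) gchoose (p + j)) * real (v choose (k - j))))"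
    by (rule sum.swap_restrict) auto
  also have "\<dots> = (\<Sum>j = 0..k. \<Sum>p = 0..j.
      ?s p j * ((real m - real (k - j) gchoose (p + j)) * real (v choose (k - j))))"
    by (intro sum.cong refl) auto
  also have "\<dots> = (\<Sum>j = 0..k. real (v choose (k - j)) * Stirling_poly j (real m - real (k - j)))"
    by (simp only: Stirling_poly_def sum_distrib_left mult_ac)
  \<comment> \<open>Substitute \<open>l = k - j\<close>.\<close>
  also have "\<dots> = rook_sum v m k"
    unfolding rook_sum_def by (subst sum.atLeastAtMost_rev) simp
  finally show ?thesis .
qed

lemma c_gen_eq_0: "2 * k < d \<Longrightarrow> c_gen s d k eps = 0"
  by (simp add: c_gen_def)

lemma RW_eq: "real (RW m k) = (\<Sum>d = 0..2 * k. cW d k (parity_pi m) * real m ^ d)"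
proof -
  \<comment> \<open>This makes \<open>m + e\<close> even, so the class is that of even sums, and
    \<open>e\<close> equals \<open>parity_pi m\<close>.\<close>
  define e where "e = m mod 2"
  have e: "e \<le> 1" by (simp add: e_def)
  have "int m - (-1) * parity_pi m = 2 * int ((m + e) div 2)"
    unfolding parity_pi_def e_def by (auto elim!: oddE evenE)
  then have "(\<Sum>d = 0..2 * k. cW d k (parity_pi m) * real m ^ d) = rook_sum ((m + e) div 2) m k"
    unfolding cW_def by (rule sum_c_gen)
  moreover have "{x \<in> board m. even (fst x + snd x)} = {x \<in> board m. even (fst x + snd x + m + e)}"
    by (auto simp: e_def mod_2_eq_odd)
  ultimately show ?thesis using count_na_parity_class[OF e, of m k] by (simp add: RW_def)
qed

lemma RK_eq: "real (RK m k) = (\<Sum>d = 0..2 * k. cK d k (parity_pi m) * real m ^ d)"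
proof -
  \<comment> \<open>Now \<open>m + e\<close> is odd, which selects odd sums, and
    \<open>(m + e) div 2\<close> rounds \<open>m / 2\<close> down.\<close>
  define e where "e = 1 - m mod 2"
  have e: "e \<le> 1" by (simp add: e_def)
  have "int m - 1 * parity_pi m = 2 * int ((m + e) div 2)"
    unfolding parity_pi_def e_def by (auto elim!: oddE evenE)
  then have "(\<Sum>d = 0..2 * k. cK d k (parity_pi m) * real m ^ d) = rook_sum ((m + e) div 2) m k"
    unfolding cK_def by (rule sum_c_gen)
  moreover have "{x \<in> board m. odd (fst x + snd x)} = {x \<in> board m. even (fst x + snd x + m + e)}"
    by (auto simp: e_def mod_2_eq_odd)
  ultimately show ?thesis using count_na_parity_class[OF e, of m k] by (simp add: RK_def)
qed

section \<open>From the two colours to the whole board\<close>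

lemma BS_eq: "BS m k = (\<Sum>j = 0..k. RW m j * RK m (k - j))"
proof -
  let ?W = "{x \<in> board m. even (fst x + snd x)}" and ?K = "{x \<in> board m. odd (fst x + snd x)}"
  have "count_na (?W \<union> ?K) k = (\<Sum>j = 0..k. count_na ?W j * count_na ?K (k - j))"
  proof (rule count_na_union_independent)
    fix x y assume "x \<in> ?W" "y \<in> ?K"
    then have "even (int (fst x) + int (snd x))" "odd (int (fst y) + int (snd y))"
      by auto
    \<comment> \<open>Both \<open>i + j\<close> and \<open>i - j\<close> have the parity of the
      colour.\<close>
    then show "\<not> same_diag x y"
      unfolding same_diag_def by presburger
  qed auto
  moreover have "?W \<union> ?K = board m" by auto
  ultimately show ?thesis by (simp add: BS_def RW_def RK_def)
qed

theorem theorem2p6: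
  fixes m k :: nat
  shows "real (RW m k) = (\<Sum>d = 0..2 * k. cW d k (parity_pi m) * real m ^ d)
    \<and> real (RK m k) = (\<Sum>d = 0..2 * k. cK d k (parity_pi m) * real m ^ d)
    \<and> real (BS m k) = (\<Sum>d = 0..2 * k.
          (\<Sum>j = 0..k. \<Sum>i = 0..d. cW i j (parity_pi m) * cK (d - i) (k - j) (parity_pi m))
          * real m ^ d)"
proof (intro conjI RW_eq RK_eq)
  let ?w = "\<lambda>j i. cW i j (parity_pi m)" and ?b = "\<lambda>j i. cK i j (parity_pi m)"
  have "real (BS m k) = (\<Sum>j = 0..k. (\<Sum>d = 0..2 * j. ?w j d * real m ^ d)
      * (\<Sum>d = 0..2 * (k - j). ?b (k - j) d * real m ^ d))"
    by (simp add: BS_eq RW_eq RK_eq)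
  also have "\<dots> = (\<Sum>j = 0..k. \<Sum>d = 0..2 * k. (\<Sum>i = 0..d. ?w j i * ?b (k - j) (d - i)) * real m ^ d)"
  proof (rule sum.cong[OF refl])
    fix j assume "j \<in> {0..k}"
    \<comment> \<open>The degree bounds add up to \<open>2 * k\<close> for every \<open>j\<close>,
      so all Cauchy products run over the same range of \<open>d\<close>.\<close>
    then have "2 * j + 2 * (k - j) = 2 * k" by auto
    then show "(\<Sum>d = 0..2 * j. ?w j d * real m ^ d) * (\<Sum>d = 0..2 * (k - j). ?b (k - j) d * real m ^ d)
        = (\<Sum>d = 0..2 * k. (\<Sum>i = 0..d. ?w j i * ?b (k - j) (d - i)) * real m ^ d)"
      using polynomial_product[of "2 * j" "?w j" "2 * (k - j)" "?b (k - j)" "real m"]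
      by (simp add: cW_def cK_def c_gen_eq_0 atMost_atLeast0)
  qed
  also have "\<dots> = (\<Sum>d = 0..2 * k. (\<Sum>j = 0..k. \<Sum>i = 0..d. ?w j i * ?b (k - j) (d - i)) * real m ^ d)"
    by (subst sum.swap) (simp only: sum_distrib_right)
  finally show "real (BS m k) = (\<Sum>d = 0..2 * k.
          (\<Sum>j = 0..k. \<Sum>i = 0..d. cW i j (parity_pi m) * cK (d - i) (k - j) (parity_pi m))
          * real m ^ d)" .
qed

end
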